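(* Let $\mathbb{K}$ be an algebraically closed field of characteristic $0$ and let $(M=M_{\bar 0}\oplus M_{\bar 1},B)$ be a finite-dimensional quadratic Malcev superalgebra over $\mathbb{K}$. Suppose that $D\in (Op_a(M))_{\bar 1}$ and $A_0\in M_{\bar 0}$ satisfy, for all $X\in M_x$, $Y\in M_y$, \begin{align*} & D^2(A_0)=\tfrac12 A_0A_0,\\ & D(A_0X)=A_0D(X)-D(A_0)X,\\ & (A_0X)Y=D(D(X)Y)+D^2(XY)+(-1)^{x}D(X)D(Y)+(-1)^{xy}D^2(Y)X,\\ & A_0(XY)=D(D(X)Y)+D^2(X)Y-(-1)^{xy}\bigl\{D^2(Y)X+D(D(Y)X)\bigr\}. \end{align*} Let $\mathbb{K}e=(\mathbb{K}e)_{\bar 1}$ be the one-dimensional abelian Malcev superalgebra with even part zero and $\mathbb{K}e^\ast$ its dual vector space. Let $M\oplus\mathbb{K}e^\ast$ be the central extension, i.e. the Malcev superalgebra with product $(X+\alpha e^\ast)(Y+\beta e^\ast)=(XY)_M-B(D(X),Y)e^\ast$. Define a map $\Omega:(\mathbb{K}e)_{\bar 1}\to Op(M\oplus\mathbb{K}e^\ast)$ by $\Omega(e)=\widetilde D$, where $\widetilde D: M\oplus\mathbb{K}e^\ast\to M\oplus\mathbb{K}e^\ast$ satisfies $\widetilde D(e^\ast)=0$ and $\widetilde D(X)=D(X)-(-1)^xB(X,A_0)e^\ast$ for $X\in M_x$ (this $\widetilde D$ is a Malcev operator of $M\oplus\mathbb{K}e^\ast$). Consider the map $\zeta:\mathbb{K}e\times\mathbb{K}e\to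 M\oplus\mathbb{K}e^\ast$ defined by $\zeta(e,e)=A_0$. Then: (a) $\mathfrak{k}=\mathbb{K}e\oplus M\oplus\mathbb{K}e^\ast$, equipped with the even (graded) skew-symmetric bilinear map on $\mathfrak{k}$ defined by \begin{align*} ee&=A_0,\\ eX&=D(X)-(-1)^xB(X,A_0)e^\ast, && X\in M_x,\\ XY&=(XY)_M-B(D(X),Y)e^\ast, && X,Y\in M,\\ e^\ast\mathfrak{k}&=\{0\}, \end{align*} is the generalized semi-direct product of $M\oplus\mathbb{K}e^\ast$ by the one-dimensional Malcev superalgebra $(\mathbb{K}e)_{\bar 1}$ (by means of $\Omega$ and $\zeta$); in particular it is a Malcev superalgebra. (b) Moreover, the supersymmetric bilinear form $\widetilde B:\mathfrak{k}\times\mathfrak{k}\to\mathbb{K}$ defined by $\widetilde B|_{M\times M}=B$, $\widetilde B(e,e^\ast)=1$, $\widetilde B(M,e)=\widetilde B(M,e^\ast)=\{0\}$, $\widetilde B(e,e)=\widetilde B(e^\ast,e^\ast)=0$ is an invariant scalar product on $\mathfrak{k}$. The quadratic Malcev superalgebra $(\mathfrak{k},\widetilde B)$ is called the generalized double extension of $(M,B)$ by the one-dimensional Malcev superalgebra $(\mathbb{K}e)_{\bar 1}$ (by means of $D$ and $A_0$).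
   Context: "Superalgebra" means $\mathbb{Z}_2$-graded algebra; $X\in M_x$ means $X$ is homogeneous of degree $x\in\mathbb{Z}_2$. $(XY)_M$ denotes the product in $M$. The elements $e$ and $e^\ast$ are odd. Malcev superalgebra: a superalgebra $M=M_{\bar 0}\oplus M_{\bar 1}$ with $XY=-(-1)^{xy}YX$ (graded skew-symmetry) and $$(-1)^{yz}(XZ)(YT)=((XY)Z)T+(-1)^{x(y+z+t)}((YZ)T)X+(-1)^{(x+y)(z+t)}((ZT)X)Y+(-1)^{t(x+y+z)}((TX)Y)Z$$ for all $X\in M_x,Y\in M_y,Z\in M_z,T\in M_t$. Quadratic: $(M,B)$ is quadratic if $B$ is a bilinear form on $M$ that is even ($B(M_{\bar 0},M_{\bar 1})=B(M_{\bar 1},M_{\bar 0})=\{0\}$), supersymmetric ($B(X,Y)=(-1)^{xy}B(Y,X)$ for $X\in M_x$, $Y\in M_y$), non-degenerate, and invariant ($B(XY,Z)=B(X,YZ)$); such a $B$ is called an invariant scalar product. Malcev operator of $M$: a linear map $\phi:M\to M$ with $$\phi((XY)Z)=(\phi(X)Y)Z-(-1)^{xy}\phi(Y)(XZ)-(-1)^{z(x+y)}(\phi(Z)X)Y-(-1)^{x(y+z)}\phi(YZ)X$$ for all $X\in M_x,Y\in M_y,Z\in M_z$. $Op(M)$ is the space of Malcev operators. A homogeneous $\phi$ of degree $\alpha$ is skew-supersymmetric if $B(\phi(X),Y)=-(-1)^{\alpha x}B(X,\phi(Y))$ for all $X\in M_x$, $Y\in M$. $(Op_a(M))_\alpha$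 denotes the space of skew-supersymmetric Malcev operators of degree $\alpha$. Generalized semi-direct product: for Malcev superalgebras $P,V$, a linear map $\Omega:P\to Op(V)$ and an even skew-supersymmetric bilinear map $\zeta:P\times P\to V$, satisfying compatibility conditions ensuring that the result is a Malcev superalgebra, this is $P\oplus V$ with product $(X+f)(Y+h)=(XY)_P+(fh)_V+\Omega(X)(h)-(-1)^{xy}\Omega(Y)(f)+\zeta(X,Y)$ for $X+f$ of degree $x$ and $Y+h$ of degree $y$. Here $P=\mathbb{K}e$ and $V=M\oplus\mathbb{K}e^\ast$.
   Formalization: The form is normalized by B̃(e*,e)=1, i.e. B̃(e,e* )=-1, instead of B̃(e,e* )=1: the printed sign fails invariance unless D=0 and A_0=0 (e.g. M=K even with zero product, D=0, A_0=1: B̃(ee,A_0)=1 but B̃(e,eA_0)=-1). *)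

theory Defs
  imports "HOL-Analysis.Product_Vector" "HOL-Computational_Algebra.Polynomial" "HOL-Library.Z2"
begin

section \<open>Superspaces and Malcev superalgebras\<close>

text \<open>Degrees are elements of the two-element field \<^typ>\<open>bit\<close>, so that the exponents occurring
  in the sign rule are evaluated modulo 2; \<open>psign x\<close> is \<open>(-1)\<^sup>x\<close>.\<close>

definition psign :: "bit \<Rightarrow> 'k::ring_1" where
  "psign x = (if x = 0 then 1 else - 1)"

locale superspace = vector_space scale
  for scale :: "'k::field \<Rightarrow> 'a::ab_group_add \<Rightarrow> 'a" (infixr \<open>*s\<close> 75) +
  fixes G :: "bit \<Rightarrow> 'a set"
  assumes subspace_G: "subspace (G x)"
    and G_inter: "G 0 \<inter> G 1 = {0}"
    and G_sum: "\<exists>u\<in>G 0. \<exists>w\<in>G 1. v = u + w"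

locale superalgebra = superspace scale G
  for scale :: "'k::field \<Rightarrow> 'a::ab_group_add \<Rightarrow> 'a" (infixr \<open>*s\<close> 75) and G +
  fixes mul :: "'a \<Rightarrow> 'a \<Rightarrow> 'a" (infixl \<open>\<cdot>\<close> 78)
  assumes mul_linear_right: "Vector_Spaces.linear scale scale (\<lambda>v. u \<cdot> v)"
    and mul_linear_left: "Vector_Spaces.linear scale scale (\<lambda>u. u \<cdot> v)"
    and mul_graded: "u \<in> G x \<Longrightarrow> v \<in> G y \<Longrightarrow> u \<cdot> v \<in> G (x + y)"

locale malcev_superalgebra = superalgebra scale G mul
  for scale :: "'k::field \<Rightarrow> 'a::ab_group_add \<Rightarrow> 'a" (infixr \<open>*s\<close> 75)
    and G and mul (infixl \<open>\<cdot>\<close> 78) +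
  assumes mul_skew: "X \<in> G x \<Longrightarrow> Y \<in> G y \<Longrightarrow> X \<cdot> Y = - (psign (x * y) *s (Y \<cdot> X))"
    and malcev_identity: "X \<in> G x \<Longrightarrow> Y \<in> G y \<Longrightarrow> Z \<in> G z \<Longrightarrow> T \<in> G t \<Longrightarrow>
      psign (y * z) *s ((X \<cdot> Z) \<cdot> (Y \<cdot> T)) =
        ((X \<cdot> Y) \<cdot> Z) \<cdot> T
        + psign (x * (y + z + t)) *s (((Y \<cdot> Z) \<cdot> T) \<cdot> X)
        + psign ((x + y) * (z + t)) *s (((Z \<cdot> T) \<cdot> X) \<cdot> Y)
        + psign (t * (x + y + z)) *s (((T \<cdot> X) \<cdot> Y) \<cdot> Z)"

locale quadratic_malcev_superalgebra = malcev_superalgebra scale G mul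
  for scale :: "'k::field \<Rightarrow> 'a::ab_group_add \<Rightarrow> 'a" (infixr \<open>*s\<close> 75)
    and G and mul (infixl \<open>\<cdot>\<close> 78) +
  fixes B :: "'a \<Rightarrow> 'a \<Rightarrow> 'k"
  assumes B_linear_right: "Vector_Spaces.linear scale (*) (\<lambda>v. B u v)"
    and B_linear_left: "Vector_Spaces.linear scale (*) (\<lambda>u. B u v)"
    and B_even: "X \<in> G 0 \<Longrightarrow> Y \<in> G 1 \<Longrightarrow> B X Y = 0" "X \<in> G 1 \<Longrightarrow> Y \<in> G 0 \<Longrightarrow> B X Y = 0"
    and B_supersym: "X \<in> G x \<Longrightarrow> Y \<in> G y \<Longrightarrow> B X Y = psign (x * y) * B Y X"
    and B_nondegenerate: "(\<And>Y. B X Y = 0) \<Longrightarrow> X = 0"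
    and B_invariant: "B (X \<cdot> Y) Z = B X (Y \<cdot> Z)"

definition malcev_ops ::
  "('k::field \<Rightarrow> 'a::ab_group_add \<Rightarrow> 'a) \<Rightarrow> (bit \<Rightarrow> 'a set) \<Rightarrow> ('a \<Rightarrow> 'a \<Rightarrow> 'a) \<Rightarrow> ('a \<Rightarrow> 'a) set" where
  "malcev_ops s G mul = {\<phi>. Vector_Spaces.linear s s \<phi> \<and>
     (\<forall>x y z. \<forall>X\<in>G x. \<forall>Y\<in>G y. \<forall>Z\<in>G z.
        \<phi> (mul (mul X Y) Z) =
          mul (mul (\<phi> X) Y) Z
          - s (psign (x * y)) (mul (\<phi> Y) (mul X Z))
          - s (psign (z * (x + y))) (mul (mul (\<phi> Z) X) Y)
          - s (psign (x * (y + z))) (mul (\<phi> (mul Y Z)) X))}"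

definition skew_malcev_ops ::
  "('k::field \<Rightarrow> 'a::ab_group_add \<Rightarrow> 'a) \<Rightarrow> (bit \<Rightarrow> 'a set) \<Rightarrow> ('a \<Rightarrow> 'a \<Rightarrow> 'a) \<Rightarrow> ('a \<Rightarrow> 'a \<Rightarrow> 'k) \<Rightarrow>
    bit \<Rightarrow> ('a \<Rightarrow> 'a) set" where
  "skew_malcev_ops s G mul B \<alpha> = {\<phi> \<in> malcev_ops s G mul.
     (\<forall>x. \<forall>X\<in>G x. \<phi> X \<in> G (x + \<alpha>)) \<and>
     (\<forall>x. \<forall>X\<in>G x. \<forall>Y. B (\<phi> X) Y = - (psign (\<alpha> * x) * B X (\<phi> Y)))}"


section \<open>Generalized semi-direct products\<close>

definition sum_grading :: "(bit \<Rightarrow> 'a set) \<Rightarrow> (bit \<Rightarrow> 'b set) \<Rightarrow> bit \<Rightarrow> ('a \<times> 'b) set" where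
  "sum_grading G H x = G x \<times> H x"

text \<open>The compatibility conditions on \<open>\<Omega>\<close> and \<open>\<zeta>\<close> are, by definition, those making the product a
  Malcev superalgebra; this is the last but one conjunct. The last conjunct determines \<open>mul\<close>,
  because \<open>mul\<close> is bilinear.\<close>

definition generalized_semidirect_product ::
  "('k::field \<Rightarrow> 'p::ab_group_add \<Rightarrow> 'p) \<Rightarrow> (bit \<Rightarrow> 'p set) \<Rightarrow> ('p \<Rightarrow> 'p \<Rightarrow> 'p) \<Rightarrow>
   ('k \<Rightarrow> 'v::ab_group_add \<Rightarrow> 'v) \<Rightarrow> (bit \<Rightarrow> 'v set) \<Rightarrow> ('v \<Rightarrow> 'v \<Rightarrow> 'v) \<Rightarrow>
   ('p \<Rightarrow> 'v \<Rightarrow> 'v) \<Rightarrow> ('p \<Rightarrow> 'p \<Rightarrow> 'v) \<Rightarrow> ('p \<times> 'v \<Rightarrow> 'p \<times> 'v \<Rightarrow> 'p \<times> 'v) \<Rightarrow> bool" where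
  "generalized_semidirect_product sP GP mP sV GV mV \<Omega> \<zeta> mul \<longleftrightarrow>
     malcev_superalgebra sP GP mP \<and>
     malcev_superalgebra sV GV mV \<and>
     (\<forall>X. \<Omega> X \<in> malcev_ops sV GV mV) \<and>
     (\<forall>f. Vector_Spaces.linear sP sV (\<lambda>X. \<Omega> X f)) \<and>
     (\<forall>X. Vector_Spaces.linear sP sV (\<lambda>Y. \<zeta> X Y)) \<and>
     (\<forall>Y. Vector_Spaces.linear sP sV (\<lambda>X. \<zeta> X Y)) \<and>
     (\<forall>x y. \<forall>X\<in>GP x. \<forall>Y\<in>GP y. \<zeta> X Y \<in> GV (x + y)) \<and>
     (\<forall>x y. \<forall>X\<in>GP x. \<forall>Y\<in>GP y. \<zeta> X Y = - sV (psign (x * y)) (\<zeta> Y X)) \<and>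
     malcev_superalgebra (module_prod.scale sP sV) (sum_grading GP GV) mul \<and>
     (\<forall>x y. \<forall>X\<in>GP x. \<forall>f\<in>GV x. \<forall>Y\<in>GP y. \<forall>h\<in>GV y.
        mul (X, f) (Y, h) =
          (mP X Y, mV f h + \<Omega> X h - sV (psign (x * y)) (\<Omega> Y f) + \<zeta> X Y))"


section \<open>Generalized double extension by an odd line\<close>

definition odd_line :: "bit \<Rightarrow> 'k::zero set" where
  "odd_line x = (if x = 1 then UNIV else {0})"

text \<open>The parity involution, \<open>X \<mapsto> (-1)\<^sup>x X\<close> for \<open>X\<close> homogeneous of degree \<open>x\<close>. It is used to
  write formulas that are given on homogeneous elements as total linear maps.\<close>

definition parity_inv :: "(bit \<Rightarrow> 'a::ab_group_add set) \<Rightarrow> 'a \<Rightarrow> 'a" where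
  "parity_inv G X = (THE Y. \<exists>u\<in>G 0. \<exists>w\<in>G 1. X = u + w \<and> Y = u - w)"

lemma (in superspace) parity_inv_homogeneous:
  assumes "X \<in> G x"
  shows "parity_inv G X = psign x *s X"
proof -
  have uniq: "u = u' \<and> w = w'"
    if "u \<in> G 0" "u' \<in> G 0" "w \<in> G 1" "w' \<in> G 1" "u + w = u' + w'" for u u' w w'
  proof -
    have eq: "u - u' = w' - w"
      using that(5) by (simp add: algebra_simps)
    have "u - u' \<in> G 0" "w' - w \<in> G 1"
      using that subspace_diff subspace_G by blast+
    then have "u - u' = 0"
      using G_inter eq by (metis IntI singletonD)
    with eq show ?thesis by simp
  qed
  have zero: "0 \<in> G y" for y
    by (rule subspace_0[OF subspace_G])
  show ?thesis
  proof (cases "x = 0")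
    case True
    with assms have X: "X \<in> G 0" by simp
    have "Y = X" if "\<exists>u\<in>G 0. \<exists>w\<in>G 1. X = u + w \<and> Y = u - w" for Y
      using that uniq[OF X _ zero] by (metis add.right_neutral diff_zero)
    then have "parity_inv G X = X"
      unfolding parity_inv_def using X zero by (intro the_equality) force+
    with True show ?thesis by (simp add: psign_def)
  next
    case False
    with assms have X: "X \<in> G 1" by simp
    have "Y = - X" if "\<exists>u\<in>G 0. \<exists>w\<in>G 1. X = u + w \<and> Y = u - w" for Y
      using that uniq[OF zero _ X] by (metis add.left_neutral diff_0)
    then have "parity_inv G X = - X"
      unfolding parity_inv_def using X zero by (intro the_equality) force+
    with False show ?thesis by (simp add: psign_def)
  qed
qed

text \<open>The underlying spaces are \<open>M \<oplus> \<K>e\<^sup>*\<close>, realised as \<^typ>\<open>'a \<times> 'k\<close>, and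
  \<open>\<K>e \<oplus> (M \<oplus> \<K>e\<^sup>*)\<close>, realised as \<^typ>\<open>'k \<times> ('a \<times> 'k)\<close>; thus \<open>e = (1, 0, 0)\<close> and
  \<open>e\<^sup>* = (0, 0, 1)\<close>.\<close>

abbreviation cext_scale :: "('k::field \<Rightarrow> 'a::ab_group_add \<Rightarrow> 'a) \<Rightarrow> 'k \<Rightarrow> 'a \<times> 'k \<Rightarrow> 'a \<times> 'k" where
  "cext_scale s \<equiv> module_prod.scale s (*)"

abbreviation cext_grading :: "(bit \<Rightarrow> 'a set) \<Rightarrow> bit \<Rightarrow> ('a \<times> 'k::zero) set" where
  "cext_grading G \<equiv> sum_grading G odd_line"

definition cext_mul ::
  "('a \<Rightarrow> 'a \<Rightarrow> 'a) \<Rightarrow> ('a \<Rightarrow> 'a \<Rightarrow> 'k::field) \<Rightarrow> ('a \<Rightarrow> 'a) \<Rightarrow> 'a \<times> 'k \<Rightarrow> 'a \<times> 'k \<Rightarrow> 'a \<times> 'k" where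
  "cext_mul mul B D = (\<lambda>(X, \<alpha>) (Y, \<beta>). (mul X Y, - B (D X) Y))"

text \<open>The map \<open>X + \<alpha> e\<^sup>* \<mapsto> D(X) - (-1)\<^sup>x B(X, A\<^sub>0) e\<^sup>*\<close>.\<close>

definition cext_op ::
  "(bit \<Rightarrow> 'a::ab_group_add set) \<Rightarrow> ('a \<Rightarrow> 'a \<Rightarrow> 'k::field) \<Rightarrow> ('a \<Rightarrow> 'a) \<Rightarrow> 'a \<Rightarrow> 'a \<times> 'k \<Rightarrow> 'a \<times> 'k" where
  "cext_op G B D A0 = (\<lambda>(X, \<alpha>). (D X, - B (parity_inv G X) A0))"

abbreviation dext_scale ::
  "('k::field \<Rightarrow> 'a::ab_group_add \<Rightarrow> 'a) \<Rightarrow> 'k \<Rightarrow> 'k \<times> 'a \<times> 'k \<Rightarrow> 'k \<times> 'a \<times> 'k" where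
  "dext_scale s \<equiv> module_prod.scale (*) (cext_scale s)"

abbreviation dext_grading :: "(bit \<Rightarrow> 'a set) \<Rightarrow> bit \<Rightarrow> ('k::zero \<times> 'a \<times> 'k) set" where
  "dext_grading G \<equiv> sum_grading odd_line (cext_grading G)"

text \<open>For \<open>X\<close> of degree \<open>x\<close> graded skew-symmetry gives
  \<open>Xe = - (-1)\<^sup>x eX = - (-1)\<^sup>x D(X) + B(X, A\<^sub>0) e\<^sup>*\<close>; these are the terms with factor \<open>b\<close>.\<close>

definition dext_mul ::
  "('k::field \<Rightarrow> 'a::ab_group_add \<Rightarrow> 'a) \<Rightarrow> (bit \<Rightarrow> 'a set) \<Rightarrow> ('a \<Rightarrow> 'a \<Rightarrow> 'a) \<Rightarrow> ('a \<Rightarrow> 'a \<Rightarrow> 'k) \<Rightarrow>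
   ('a \<Rightarrow> 'a) \<Rightarrow> 'a \<Rightarrow> 'k \<times> 'a \<times> 'k \<Rightarrow> 'k \<times> 'a \<times> 'k \<Rightarrow> 'k \<times> 'a \<times> 'k" where
  "dext_mul s G mul B D A0 = (\<lambda>(a, X, \<alpha>) (b, Y, \<beta>).
     (0,
      s (a * b) A0 + s a (D Y) - s b (D (parity_inv G X)) + mul X Y,
      - (a * B (parity_inv G Y) A0) + b * B X A0 - B (D X) Y))"

text \<open>The supersymmetric form extending \<open>B\<close> with \<open>M \<bottom> \<K>e \<oplus> \<K>e\<^sup>*\<close>, \<open>e\<close> and \<open>e\<^sup>*\<close> isotropic and
  value \<open>1\<close> at \<open>(e\<^sup>*, e)\<close>. As \<open>e\<close> and \<open>e\<^sup>*\<close> are odd, this means that its value at \<open>(e, e\<^sup>*)\<close> is \<open>-1\<close>.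
  With the product above the opposite normalisation is invariant only if \<open>D = 0\<close>: invariance on
  \<open>(e, X, Y)\<close> reads \<open>B(D(X), Y) = - B(D(X), Y) c\<close>, where \<open>c\<close> is the value at \<open>(e, e\<^sup>*)\<close>.\<close>

definition dext_form ::
  "('a \<Rightarrow> 'a \<Rightarrow> 'k::field) \<Rightarrow> 'k \<times> 'a \<times> 'k \<Rightarrow> 'k \<times> 'a \<times> 'k \<Rightarrow> 'k" where
  "dext_form B = (\<lambda>(a, X, \<alpha>) (b, Y, \<beta>). B X Y + \<alpha> * b - a * \<beta>)"

end

theory Submission
  imports Defs
begin

text \<open>Modulo the central line \<open>\<K>e\<^sup>*\<close>, the Malcev identity of \<open>\<kk>\<close> is checked on \<open>e\<close> and \<open>M\<close>. By cyclic
  symmetry only the number and the relative position of the arguments equal to \<open>e\<close> matter: without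
  \<open>e\<close> it is the Malcev identity of \<open>M\<close>, with one \<open>e\<close> it says that \<open>D\<close> is a Malcev operator, with two
  adjacent or two opposite \<open>e\<close> it is one of the last two hypotheses, with three \<open>e\<close> it is
  \<open>D(A\<^sub>0X) = A\<^sub>0D(X) - D(A\<^sub>0)X\<close>, and with four it reduces to \<open>A\<^sub>0A\<^sub>0 = 0\<close>. The form \<open>B\<close> extends to an
  invariant form on \<open>\<kk>\<close>, and invariance lets an argument from \<open>M \<oplus> \<K>e\<^sup>*\<close> change places with \<open>e\<close>, which
  turns the \<open>e\<^sup>*\<close>-coordinate of the identity into the part already known. Finally the identities of
  \<open>M \<oplus> \<K>e\<^sup>*\<close> and of the Malcev operator \<open>\<Omega>(e)\<close> are those of \<open>\<kk>\<close> with no and with one argument \<open>e\<close>.\<close>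

lemma psign_0 [simp]: "psign 0 = 1" and psign_1 [simp]: "psign 1 = - 1"
  by (simp_all add: psign_def)

section \<open>Product superspaces and the parity involution\<close>

lemma superspace_prod:
  assumes "superspace s1 G1" "superspace s2 G2"
  shows "superspace (module_prod.scale s1 s2) (sum_grading G1 G2)"
proof -
  interpret a: superspace s1 G1 by fact
  interpret b: superspace s2 G2 by fact
  interpret vector_space_prod s1 s2 ..
  show ?thesis
  proof unfold_locales
    show "p.subspace (sum_grading G1 G2 x)" for x
      unfolding sum_grading_def by (rule subspace_Times[OF a.subspace_G b.subspace_G])
    show "sum_grading G1 G2 0 \<inter> sum_grading G1 G2 1 = {0}"
      using a.G_inter b.G_inter unfolding sum_grading_def zero_prod_def by auto
    show "\<exists>u\<in>sum_grading G1 G2 0. \<exists>w\<in>sum_grading G1 G2 1. v = u + w" for v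
    proof -
      obtain u1 w1 where 1: "u1 \<in> G1 0" "w1 \<in> G1 1" "fst v = u1 + w1"
        using a.G_sum by blast
      obtain u2 w2 where 2: "u2 \<in> G2 0" "w2 \<in> G2 1" "snd v = u2 + w2"
        using b.G_sum by blast
      show ?thesis
        using 1 2 unfolding sum_grading_def
        by (intro bexI[of _ "(u1, u2)"] bexI[of _ "(w1, w2)"]) (auto simp: prod_eq_iff)
    qed
  qed
qed

lemma superspace_odd_line: "superspace (*) (odd_line :: bit \<Rightarrow> 'k::field set)"
proof -
  interpret vector_space "(*) :: 'k \<Rightarrow> 'k \<Rightarrow> 'k"
    by unfold_locales (simp_all add: algebra_simps)
  show ?thesis
    by unfold_locales (auto simp: odd_line_def subspace_def)
qed

context superspace
begin

text \<open>Homogeneous components are unique because \<open>G 0\<close> and \<open>G 1\<close> meet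
  only in 0, so the description defining \<open>parity_inv\<close> is determined on mixed vectors
  too. Linearity of the involution follows from this.\<close>

lemma parity_inv_eq:
  assumes "u \<in> G 0" "w \<in> G 1"
  shows "parity_inv G (u + w) = u - w"
proof -
  have "u' = u \<and> w' = w" if "u' \<in> G 0" "w' \<in> G 1" "u + w = u' + w'" for u' w'
  proof -
    have eq: "u' - u = w - w'"
      using that(3) by (simp add: algebra_simps)
    have "u' - u \<in> G 0" "w - w' \<in> G 1"
      using that assms subspace_diff subspace_G by blast+
    then have "u' - u = 0"
      using G_inter eq by (metis IntI singletonD)
    with eq show ?thesis by simp
  qed
  then show ?thesis
    unfolding parity_inv_def using assms by (intro the_equality) blast+
qed

lemma parity_inv_add: "parity_inv G (X + Y) = parity_inv G X + parity_inv G Y"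
proof -
  obtain u w where X: "u \<in> G 0" "w \<in> G 1" "X = u + w" using G_sum by blast
  obtain u' w' where Y: "u' \<in> G 0" "w' \<in> G 1" "Y = u' + w'" using G_sum by blast
  have "parity_inv G ((u + u') + (w + w')) = (u + u') - (w + w')"
    using X Y by (intro parity_inv_eq subspace_add[OF subspace_G])
  with X Y show ?thesis
    by (simp add: parity_inv_eq algebra_simps)
qed

lemma parity_inv_scale: "parity_inv G (c *s X) = c *s parity_inv G X"
proof -
  obtain u w where X: "u \<in> G 0" "w \<in> G 1" "X = u + w" using G_sum by blast
  have "parity_inv G (c *s u + c *s w) = c *s u - c *s w"
    using X by (intro parity_inv_eq subspace_scale[OF subspace_G])
  with X show ?thesis
    by (simp add: parity_inv_eq scale_right_distrib scale_right_diff_distrib)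
qed

end

section \<open>The Malcev defect\<close>

text \<open>This keeps all of a Malcev superalgebra except the identity itself, so that the failure
  of the identity can be studied on the double extension before it is known to vanish.\<close>

locale skew_superalgebra = superalgebra scale G mul
  for scale :: "'k::field \<Rightarrow> 'a::ab_group_add \<Rightarrow> 'a" (infixr \<open>*s\<close> 75)
    and G and mul (infixl \<open>\<cdot>\<close> 78) +
  assumes mul_skew: "X \<in> G x \<Longrightarrow> Y \<in> G y \<Longrightarrow> X \<cdot> Y = - (psign (x * y) *s (Y \<cdot> X))"
begin

lemma mul_add_left: "(u + v) \<cdot> w = u \<cdot> w + v \<cdot> w"
  and mul_scale_left: "(c *s u) \<cdot> w = c *s (u \<cdot> w)"
  using mul_linear_left[of w] by (simp_all add: Vector_Spaces.linear_iff)

lemma mul_add_right: "w \<cdot> (u + v) = w \<cdot> u + w \<cdot> v"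
  and mul_scale_right: "w \<cdot> (c *s u) = c *s (w \<cdot> u)"
  using mul_linear_right[of w] by (simp_all add: Vector_Spaces.linear_iff)

lemma mul_minus_left: "(- u) \<cdot> v = - (u \<cdot> v)"
  using mul_scale_left[of "-1" u v] by simp

lemma mul_minus_right: "u \<cdot> (- v) = - (u \<cdot> v)"
  using mul_scale_right[of u "-1" v] by simp

text \<open>The degrees are separate arguments: with the signs fixed, the expression is linear in
  each slot, also on inhomogeneous vectors.\<close>

definition malcev_defect :: "bit \<Rightarrow> bit \<Rightarrow> bit \<Rightarrow> bit \<Rightarrow> 'a \<Rightarrow> 'a \<Rightarrow> 'a \<Rightarrow> 'a \<Rightarrow> 'a" where
  "malcev_defect x y z t X Y Z T =
     ((X \<cdot> Y) \<cdot> Z) \<cdot> T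
     + psign (x * (y + z + t)) *s (((Y \<cdot> Z) \<cdot> T) \<cdot> X)
     + psign ((x + y) * (z + t)) *s (((Z \<cdot> T) \<cdot> X) \<cdot> Y)
     + psign (t * (x + y + z)) *s (((T \<cdot> X) \<cdot> Y) \<cdot> Z)
     - psign (y * z) *s ((X \<cdot> Z) \<cdot> (Y \<cdot> T))"

lemma malcev_superalgebra_iff:
  "malcev_superalgebra scale G mul \<longleftrightarrow>
     (\<forall>x y z t. \<forall>X\<in>G x. \<forall>Y\<in>G y. \<forall>Z\<in>G z. \<forall>T\<in>G t. malcev_defect x y z t X Y Z T = 0)"
proof -
  have eq: "malcev_defect x y z t X Y Z T = 0 \<longleftrightarrow>
      psign (y * z) *s ((X \<cdot> Z) \<cdot> (Y \<cdot> T)) =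
        ((X \<cdot> Y) \<cdot> Z) \<cdot> T
        + psign (x * (y + z + t)) *s (((Y \<cdot> Z) \<cdot> T) \<cdot> X)
        + psign ((x + y) * (z + t)) *s (((Z \<cdot> T) \<cdot> X) \<cdot> Y)
        + psign (t * (x + y + z)) *s (((T \<cdot> X) \<cdot> Y) \<cdot> Z)" for x y z t X Y Z T
    unfolding malcev_defect_def right_minus_eq by (rule eq_commute)
  show ?thesis
  proof (intro iffI ballI allI)
    fix x y z t X Y Z T
    assume *: "malcev_superalgebra scale G mul" and mem: "X \<in> G x" "Y \<in> G y" "Z \<in> G z" "T \<in> G t"
    show "malcev_defect x y z t X Y Z T = 0"
      unfolding eq by (rule malcev_superalgebra.malcev_identity[OF * mem])
  next
    assume *: "\<forall>x y z t. \<forall>X\<in>G x. \<forall>Y\<in>G y. \<forall>Z\<in>G z. \<forall>T\<in>G t. malcev_defect x y z t X Y Z T = 0"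
    show "malcev_superalgebra scale G mul"
      by unfold_locales (rule mul_skew, assumption+, rule eq[THEN iffD1], simp add: *)
  qed
qed

lemma linear_malcev_defect:
  "Vector_Spaces.linear scale scale (\<lambda>X. malcev_defect x y z t X Y Z T)"
  "Vector_Spaces.linear scale scale (\<lambda>Y. malcev_defect x y z t X Y Z T)"
  "Vector_Spaces.linear scale scale (\<lambda>Z. malcev_defect x y z t X Y Z T)"
  "Vector_Spaces.linear scale scale (\<lambda>T. malcev_defect x y z t X Y Z T)"
  unfolding Vector_Spaces.linear_iff malcev_defect_def
  by (simp_all add: vector_space_axioms mul_add_left mul_add_right mul_scale_left mul_scale_right
      scale_right_distrib scale_right_diff_distrib mult.commute)

text \<open>A rotation permutes the four triple products, up to the sign for moving \<open>X\<close>
  past the other arguments. Only \<open>(XZ)(YT)\<close> changes shape, into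
  \<open>(YT)(ZX)\<close>, and two uses of skew-symmetry turn it back.\<close>

lemma malcev_defect_cycle:
  assumes "X \<in> G x" "Y \<in> G y" "Z \<in> G z" "T \<in> G t"
  shows "malcev_defect y z t x Y Z T X =
    psign (x * (y + z + t)) *s malcev_defect x y z t X Y Z T"
proof -
  have 1: "Z \<cdot> X = - (psign (z * x) *s (X \<cdot> Z))"
    using assms by (intro mul_skew)
  have 2: "(Y \<cdot> T) \<cdot> (X \<cdot> Z) = - (psign ((y + t) * (x + z)) *s ((X \<cdot> Z) \<cdot> (Y \<cdot> T)))"
    using assms by (intro mul_skew mul_graded)
  show ?thesis
    unfolding malcev_defect_def 1 mul_minus_right mul_scale_right 2
    by (cases x; cases y; cases z; cases t) (simp_all add: algebra_simps)
qed

text \<open>For an invariant form the defect is, up to sign and order of the arguments, cyclically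
  symmetric in all five slots.\<close>

lemma malcev_defect_invariant:
  fixes b :: "'a \<Rightarrow> 'a \<Rightarrow> 'k"
  assumes lin: "\<And>v. Vector_Spaces.linear scale (*) (\<lambda>u. b u v)"
      "\<And>u. Vector_Spaces.linear scale (*) (\<lambda>v. b u v)"
    and inv: "\<And>u v w. b (u \<cdot> v) w = b u (v \<cdot> w)"
    and X: "X \<in> G x" and Y: "Y \<in> G y" and Z: "Z \<in> G z" and T: "T \<in> G t" and U: "U \<in> G u"
  shows "b (malcev_defect x y z t X Y Z T) U = psign (y * z) * b X (malcev_defect z y t u Z Y T U)"
proof -
  have b_add: "b (v + v') w = b v w + b v' w" "b w (v + v') = b w v + b w v'"
    and b_scale: "b (c *s v) w = c * b v w" "b w (c *s v) = c * b w v" for v v' w c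
    using lin by (simp_all add: Vector_Spaces.linear_iff)
  have b_minus: "b (- v) w = - b v w" "b w (- v) = - b w v" for v w
    using b_scale(1)[of "-1" v w] b_scale(2)[of w "-1" v] by simp_all
  have b_diff: "b (v - v') w = b v w - b v' w" "b w (v - v') = b w v - b w v'" for v v' w
    using b_add[of v "- v'" w] b_add[of w v "- v'"] b_minus by simp_all
  \<comment> \<open>On the left these rules bring \<open>X\<close> to the front, where invariance
    strips it off; on the right they restore a common order. Both sides then pair \<open>X\<close>
    with the same five products: \<open>Y(Z(TU))\<close>, \<open>((YZ)T)U\<close>,
    \<open>(ZT)(YU)\<close>, \<open>T(Y(ZU))\<close> and \<open>Z((YT)U)\<close>.\<close>
  note skew =
    mul_skew[OF mul_graded[OF mul_graded[OF Y Z] T] X] mul_skew[OF mul_graded[OF Z T] X]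
    mul_skew[OF T X] mul_skew[OF Z Y] mul_skew[OF mul_graded[OF mul_graded[OF Y T] U] Z]
    mul_skew[OF mul_graded[OF T U] Z] mul_skew[OF mul_graded[OF Z mul_graded[OF T U]] Y]
    mul_skew[OF U Z] mul_skew[OF mul_graded[OF Z U] Y]
    mul_skew[OF mul_graded[OF Y mul_graded[OF Z U]] T]
  show ?thesis
    unfolding malcev_defect_def
    by (simp only: skew b_add b_diff b_minus b_scale inv
        mul_minus_left mul_minus_right mul_scale_left mul_scale_right)
      (cases x; cases y; cases z; cases t; cases u; simp add: algebra_simps)
qed

text \<open>The criterion is applied twice, which is why \<open>N\<close> is left open: first with
  \<open>N\<close> the central line, then with \<open>N\<close> = {0}. The set \<open>W\<close>
  stands for the vectors without \<open>e\<close>-component.\<close>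

lemma malcev_defect_mem:
  assumes N: "subspace N"
    and e: "e \<in> G 1"
    and even: "\<And>u. u \<in> G 0 \<Longrightarrow> u \<in> W"
    and odd: "\<And>u. u \<in> G 1 \<Longrightarrow> \<exists>a. \<exists>w\<in>W \<inter> G 1. u = a *s e + w"
    and WWWW: "\<And>x y z t X Y Z T. X \<in> W \<inter> G x \<Longrightarrow> Y \<in> W \<inter> G y \<Longrightarrow> Z \<in> W \<inter> G z \<Longrightarrow>
      T \<in> W \<inter> G t \<Longrightarrow> malcev_defect x y z t X Y Z T \<in> N"
    and eWWW: "\<And>y z t Y Z T. Y \<in> W \<inter> G y \<Longrightarrow> Z \<in> W \<inter> G z \<Longrightarrow> T \<in> W \<inter> G t \<Longrightarrow>
      malcev_defect 1 y z t e Y Z T \<in> N"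
    and eeWW: "\<And>z t Z T. Z \<in> W \<inter> G z \<Longrightarrow> T \<in> W \<inter> G t \<Longrightarrow> malcev_defect 1 1 z t e e Z T \<in> N"
    and eWeW: "\<And>y t Y T. Y \<in> W \<inter> G y \<Longrightarrow> T \<in> W \<inter> G t \<Longrightarrow> malcev_defect 1 y 1 t e Y e T \<in> N"
    and eeeW: "\<And>t T. T \<in> W \<inter> G t \<Longrightarrow> malcev_defect 1 1 1 t e e e T \<in> N"
    and eeee: "malcev_defect 1 1 1 1 e e e e \<in> N"
    and X: "X \<in> G x" and Y: "Y \<in> G y" and Z: "Z \<in> G z" and T: "T \<in> G t"
  shows "malcev_defect x y z t X Y Z T \<in> N"
proof -
  \<comment> \<open>It suffices to test the multilinear defect on the generators \<open>E\<close>; rotations bring each of the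
    16 patterns in \<open>e\<close> and \<open>W\<close> into one of the six listed.\<close>
  define E where "E x = W \<inter> G x \<union> (if x = 1 then {e} else {})" for x
  have E_cases: "u \<in> W \<inter> G x \<or> x = 1 \<and> u = e" if "u \<in> E x" for u x
    using that by (auto simp: E_def split: if_splits)
  have E_G: "u \<in> G x" if "u \<in> E x" for u x
    using E_cases[OF that] e by auto
  have rot: "malcev_defect x y z t X Y Z T \<in> N"
    if "malcev_defect y z t x Y Z T X \<in> N" "X \<in> G x" "Y \<in> G y" "Z \<in> G z" "T \<in> G t"
    for x y z t X Y Z T
  proof -
    have "psign (x * (y + z + t)) *s malcev_defect y z t x Y Z T X = malcev_defect x y z t X Y Z T"
      unfolding malcev_defect_cycle[OF that(2-5)] by (simp add: psign_def)
    then show ?thesis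
      using subspace_scale[OF N that(1)] by metis
  qed
  have extend: "f u \<in> N"
    if f: "Vector_Spaces.linear scale scale f" and *: "\<And>w. w \<in> E x \<Longrightarrow> f w \<in> N" and u: "u \<in> G x"
    for f x u
  proof (cases "x = 0")
    case True
    then show ?thesis using * u even by (simp add: E_def)
  next
    case False
    then have 1: "x = 1" by simp
    then obtain a w where w: "w \<in> W \<inter> G 1" "u = a *s e + w" using odd u by blast
    have "f w \<in> N" "f e \<in> N" using * w 1 by (simp_all add: E_def)
    then show ?thesis
      using f w N by (simp add: Vector_Spaces.linear_iff subspace_add subspace_scale)
  qed
  have base: "malcev_defect x y z t X Y Z T \<in> N"
    if E: "X \<in> E x" "Y \<in> E y" "Z \<in> E z" "T \<in> E t" for x y z t X Y Z T
  proof -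
    note G = E[THEN E_G]
    \<comment> \<open>\<open>r1\<close>, \<open>r2\<close> and \<open>r3\<close> reduce the claim to
      the tuple rotated by one, two and three places.\<close>
    note r1 = rot[OF _ G]
    note r2 = r1[OF rot[OF _ G(2,3,4,1)]]
    note r3 = r2[OF rot[OF _ G(3,4,1,2)]]
    show ?thesis
      using E[THEN E_cases] WWWW eWWW eeWW eWeW eeeW eeee r1 r2 r3 by (elim disjE conjE) metis+
  qed
  \<comment> \<open>Linearity lifts the restriction to \<open>E\<close> one slot at a time,
    beginning with the first.\<close>
  have 1: "malcev_defect x y z t X Y Z T \<in> N" if "Y \<in> E y" "Z \<in> E z" "T \<in> E t" "X \<in> G x" for X Y Z T
    by (rule extend[OF linear_malcev_defect(1)]) (use that base in auto)
  have 2: "malcev_defect x y z t X Y Z T \<in> N" if "Z \<in> E z" "T \<in> E t" "X \<in> G x" "Y \<in> G y" for X Y Z T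
    by (rule extend[OF linear_malcev_defect(2)]) (use that 1 in auto)
  have 3: "malcev_defect x y z t X Y Z T \<in> N" if "T \<in> E t" "X \<in> G x" "Y \<in> G y" "Z \<in> G z" for X Y Z T
    by (rule extend[OF linear_malcev_defect(3)]) (use that 2 in auto)
  show ?thesis
    by (rule extend[OF linear_malcev_defect(4)]) (use X Y Z T 3 in auto)
qed

end

sublocale malcev_superalgebra \<subseteq> skew_superalgebra
  by unfold_locales (rule mul_skew)

text \<open>In the Malcev identity with first argument \<open>e\<close>, skew-symmetry brings
  \<open>e\<close> to the left of each product. The signs this costs cancel those due to the degree
  of \<open>e\<close>, which leaves the condition on a Malcev operator, where the degree of the
  operator does not occur.\<close>

lemma (in malcev_superalgebra) odd_left_mult_malcev_op:
  assumes e: "e \<in> G 1"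
  shows "(\<lambda>X. e \<cdot> X) \<in> malcev_ops scale G mul"
proof -
  have "e \<cdot> ((X \<cdot> Y) \<cdot> Z) =
      ((e \<cdot> X) \<cdot> Y) \<cdot> Z
      - psign (x * y) *s ((e \<cdot> Y) \<cdot> (X \<cdot> Z))
      - psign (z * (x + y)) *s (((e \<cdot> Z) \<cdot> X) \<cdot> Y)
      - psign (x * (y + z)) *s ((e \<cdot> (Y \<cdot> Z)) \<cdot> X)"
    if X: "X \<in> G x" and Y: "Y \<in> G y" and Z: "Z \<in> G z" for x y z X Y Z
  proof -
    note skew = mul_skew[OF mul_graded[OF mul_graded[OF X Y] Z] e] mul_skew[OF mul_graded[OF Y Z] e]
      mul_skew[OF Z e]
    show ?thesis
      using malcev_identity[OF e X Y Z] unfolding skew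
      by (cases x; cases y; cases z) (simp_all add: mul_minus_left algebra_simps)
  qed
  then show ?thesis
    unfolding malcev_ops_def using mul_linear_right by blast
qed

section \<open>The generalized double extension\<close>

locale double_extension_datum = quadratic_malcev_superalgebra scale G mul B
  for scale :: "'k::field_char_0 \<Rightarrow> 'a::ab_group_add \<Rightarrow> 'a" (infixr \<open>*s\<close> 75)
    and G and mul (infixl \<open>\<cdot>\<close> 78) and B +
  fixes D :: "'a \<Rightarrow> 'a" and A0 :: 'a
  assumes D_op: "D \<in> skew_malcev_ops scale G mul B 1"
    and A0_even: "A0 \<in> G 0"
    and D_A0_mul: "X \<in> G x \<Longrightarrow> D (A0 \<cdot> X) = A0 \<cdot> D X - D A0 \<cdot> X"
    and A0_mul_mul: "X \<in> G x \<Longrightarrow> Y \<in> G y \<Longrightarrow>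
      (A0 \<cdot> X) \<cdot> Y =
        D (D X \<cdot> Y) + D (D (X \<cdot> Y)) + psign x *s (D X \<cdot> D Y) + psign (x * y) *s (D (D Y) \<cdot> X)"
    and mul_A0_mul: "X \<in> G x \<Longrightarrow> Y \<in> G y \<Longrightarrow>
      A0 \<cdot> (X \<cdot> Y) =
        D (D X \<cdot> Y) + D (D X) \<cdot> Y - psign (x * y) *s (D (D Y) \<cdot> X + D (D Y \<cdot> X))"
begin

abbreviation "P \<equiv> parity_inv G"

lemma D_linear: "Vector_Spaces.linear scale scale D"
  and D_graded: "X \<in> G x \<Longrightarrow> D X \<in> G (x + 1)"
  and D_skew: "X \<in> G x \<Longrightarrow> B (D X) Y = - (psign x * B X (D Y))"
  and D_malcev: "X \<in> G x \<Longrightarrow> Y \<in> G y \<Longrightarrow> Z \<in> G z \<Longrightarrow>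
    D ((X \<cdot> Y) \<cdot> Z) = (D X \<cdot> Y) \<cdot> Z - psign (x * y) *s (D Y \<cdot> (X \<cdot> Z))
      - psign (z * (x + y)) *s ((D Z \<cdot> X) \<cdot> Y) - psign (x * (y + z)) *s (D (Y \<cdot> Z) \<cdot> X)"
  using D_op by (auto simp: skew_malcev_ops_def malcev_ops_def)

lemma D_add: "D (X + Y) = D X + D Y" and D_scale: "D (c *s X) = c *s D X"
  using D_linear by (simp_all add: Vector_Spaces.linear_iff)

lemma D_minus: "D (- X) = - D X"
  using D_scale[of "-1" X] by simp

lemma D_diff: "D (X - Y) = D X - D Y"
  using D_add[of X "- Y"] by (simp add: D_minus)

lemma D_0 [simp]: "D 0 = 0"
  using D_scale[of 0 0] by simp

lemma B_add: "B (X + Y) Z = B X Z + B Y Z" "B Z (X + Y) = B Z X + B Z Y"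
  and B_scale: "B (c *s X) Z = c * B X Z" "B Z (c *s X) = c * B Z X"
  using B_linear_left B_linear_right by (simp_all add: Vector_Spaces.linear_iff)

lemma B_minus: "B (- X) Z = - B X Z" "B Z (- X) = - B Z X"
  using B_scale(1)[of "-1" X Z] B_scale(2)[of Z "-1" X] by simp_all

lemma B_diff: "B (X - Y) Z = B X Z - B Y Z" "B Z (X - Y) = B Z X - B Z Y"
  using B_add[of X "- Y" Z] B_add[of Z X "- Y"] by (simp_all add: B_minus)

lemma B_0 [simp]: "B 0 X = 0" "B X 0 = 0"
  using B_scale(1)[of 0 0 X] B_scale(2)[of X 0 0] by simp_all

lemma mul_0 [simp]: "0 \<cdot> X = 0" "X \<cdot> 0 = 0"
  using mul_scale_left[of 0 0 X] mul_scale_right[of X 0 0] by simp_all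

lemma zero_mem [simp]: "0 \<in> G x"
  by (rule subspace_0[OF subspace_G])

lemma P_even: "X \<in> G 0 \<Longrightarrow> P X = X" and P_odd: "X \<in> G 1 \<Longrightarrow> P X = - X"
  using parity_inv_homogeneous by (simp_all add: psign_def)

lemma P_0 [simp]: "P 0 = 0"
  using P_even[of 0] by simp

lemma homogeneous_decomp:
  obtains u w where "u \<in> G 0" "w \<in> G 1" "X = u + w"
  using G_sum by blast

text \<open>Skew-symmetry in even degree makes twice the square zero, and the characteristic is
  zero.\<close>

lemma A0_square: "A0 \<cdot> A0 = 0"
proof -
  have "(1 + 1) *s (A0 \<cdot> A0) = 0"
    using mul_skew[OF A0_even A0_even] unfolding scale_left_distrib by (simp add: eq_neg_iff_add_eq_0)
  then show ?thesis
    by simp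
qed

text \<open>As \<open>A0\<close> and \<open>B\<close> are even, only the even component of the other
  argument counts; on it the parity involution is trivial and \<open>B\<close> is symmetric.\<close>

lemma B_A0_P: "B (P X) A0 = B X A0" and B_A0_commute: "B A0 X = B X A0"
proof -
  obtain u w where X: "u \<in> G 0" "w \<in> G 1" "X = u + w" by (rule homogeneous_decomp)
  have "B w A0 = 0" "B A0 w = 0" "B A0 u = B u A0"
    using B_even[of A0 w] B_even[of w A0] B_supersym[of A0 0 u 0] X A0_even by simp_all
  then show "B (P X) A0 = B X A0" "B A0 X = B X A0"
    using X by (simp_all add: parity_inv_eq B_diff B_add)
qed

text \<open>The sign in the skew-supersymmetry of \<open>D\<close> is that of the parity involution.
  Once absorbed there, the rule holds for all vectors.\<close>

lemma B_D_P_left: "B (D (P X)) Y = - B X (D Y)"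
proof -
  obtain u w where X: "u \<in> G 0" "w \<in> G 1" "X = u + w" by (rule homogeneous_decomp)
  then show ?thesis
    using D_skew[of u 0 Y] D_skew[of w 1 Y] by (simp add: parity_inv_eq B_add D_diff B_diff)
qed

text \<open>Since \<open>D\<close> is odd and \<open>B\<close> even, \<open>B X (D Y)\<close> only
  sees components of \<open>X\<close> and \<open>Y\<close> of opposite degree. The sign of
  \<open>Y\<close> is therefore minus that of \<open>X\<close>, as skew-supersymmetry
  requires.\<close>

lemma B_D_P_right: "B X (D (P Y)) = B (D X) Y"
proof -
  obtain u w where X: "u \<in> G 0" "w \<in> G 1" "X = u + w" by (rule homogeneous_decomp)
  obtain u' w' where Y: "u' \<in> G 0" "w' \<in> G 1" "Y = u' + w'" by (rule homogeneous_decomp)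
  have "B u (D u') = 0" "B w (D w') = 0"
    using X Y D_graded[of u' 0] D_graded[of w' 1] by (simp_all add: B_even)
  then show ?thesis
    using X Y D_skew[of u 0] D_skew[of w 1]
    by (simp add: parity_inv_eq D_add D_diff B_add B_diff)
qed

section \<open>The graded skew-symmetric product of the double extension\<close>

abbreviation "kscale \<equiv> dext_scale scale"
abbreviation "kG \<equiv> dext_grading G :: bit \<Rightarrow> ('k \<times> 'a \<times> 'k) set"
abbreviation kmul (infixl \<open>\<odot>\<close> 78) where "kmul \<equiv> dext_mul scale G mul B D A0"
abbreviation "vscale \<equiv> cext_scale scale"
abbreviation "vG \<equiv> cext_grading G :: bit \<Rightarrow> ('a \<times> 'k) set"
abbreviation "vmul \<equiv> cext_mul mul B D"

lemma superspace_cext: "superspace vscale vG"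
  by (rule superspace_prod[OF superspace_axioms superspace_odd_line])

lemma superspace_dext: "superspace kscale kG"
  by (rule superspace_prod[OF superspace_odd_line superspace_cext])

lemma vscale_Pair: "vscale c (X, \<alpha>) = (c *s X, c * \<alpha>)"
proof -
  interpret line: superspace "(*)" "odd_line :: bit \<Rightarrow> 'k set" by (rule superspace_odd_line)
  interpret vector_space_prod scale "(*) :: 'k \<Rightarrow> 'k \<Rightarrow> 'k" ..
  show ?thesis by (rule scale_prod)
qed

lemma kscale_Pair: "kscale c (a, X, \<alpha>) = (c * a, c *s X, c * \<alpha>)"
proof -
  interpret line: superspace "(*)" "odd_line :: bit \<Rightarrow> 'k set" by (rule superspace_odd_line)
  interpret v: superspace vscale vG by (rule superspace_cext)
  interpret vector_space_prod "(*) :: 'k \<Rightarrow> 'k \<Rightarrow> 'k" vscale ..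
  show ?thesis by (simp add: scale_prod vscale_Pair)
qed

lemma kmul_Pair:
  "(a, X, \<alpha>) \<odot> (b, Y, \<beta>) =
     (0, (a * b) *s A0 + a *s D Y - b *s D (P X) + X \<cdot> Y, - (a * B Y A0) + b * B X A0 - B (D X) Y)"
  by (simp add: dext_mul_def B_A0_P)

lemma vmul_Pair: "vmul (X, \<alpha>) (Y, \<beta>) = (X \<cdot> Y, - B (D X) Y)"
  by (simp add: cext_mul_def)

lemma vG_iff: "(X, \<alpha>) \<in> vG x \<longleftrightarrow> X \<in> G x \<and> (x = 0 \<longrightarrow> \<alpha> = 0)"
  by (auto simp: sum_grading_def odd_line_def)

lemma kG_iff: "(a, X, \<alpha>) \<in> kG x \<longleftrightarrow> X \<in> G x \<and> (x = 0 \<longrightarrow> a = 0 \<and> \<alpha> = 0)"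
  by (auto simp: sum_grading_def odd_line_def)

lemma G_mul_simps:
  "X \<in> G 0 \<Longrightarrow> Y \<in> G 0 \<Longrightarrow> X \<cdot> Y \<in> G 0" "X \<in> G 1 \<Longrightarrow> Y \<in> G 1 \<Longrightarrow> X \<cdot> Y \<in> G 0"
  "X \<in> G 0 \<Longrightarrow> Y \<in> G 1 \<Longrightarrow> X \<cdot> Y \<in> G 1" "X \<in> G 1 \<Longrightarrow> Y \<in> G 0 \<Longrightarrow> X \<cdot> Y \<in> G 1"
  using mul_graded[of X _ Y] by force+

lemma G_D_simps: "X \<in> G 0 \<Longrightarrow> D X \<in> G 1" "X \<in> G 1 \<Longrightarrow> D X \<in> G 0"
  using D_graded[of X] by force+

lemma G_simps:
  "X \<in> G x \<Longrightarrow> - X \<in> G x" "X \<in> G x \<Longrightarrow> Y \<in> G x \<Longrightarrow> X + Y \<in> G x"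
  "X \<in> G x \<Longrightarrow> Y \<in> G x \<Longrightarrow> X - Y \<in> G x" "X \<in> G x \<Longrightarrow> c *s X \<in> G x"
  using subspace_G by (auto simp: subspace_neg subspace_add subspace_diff subspace_scale)

lemmas grade_simps = G_mul_simps G_D_simps G_simps A0_even P_even P_odd

lemma skew_superalgebra_dext: "skew_superalgebra kscale kG kmul"
proof -
  interpret k: superspace kscale kG by (rule superspace_dext)
  show ?thesis
  proof (intro skew_superalgebra.intro superalgebra.intro superalgebra_axioms.intro
      skew_superalgebra_axioms.intro superspace_dext)
    show "Vector_Spaces.linear kscale kscale (\<lambda>v. u \<odot> v)" for u
      unfolding Vector_Spaces.linear_iff
      by (cases u) (auto simp: k.vector_space_axioms kmul_Pair kscale_Pair D_add D_scale B_add B_scale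
        mul_add_right mul_scale_right algebra_simps)
    show "Vector_Spaces.linear kscale kscale (\<lambda>u. u \<odot> v)" for v
      unfolding Vector_Spaces.linear_iff
      by (cases v) (auto simp: k.vector_space_axioms kmul_Pair kscale_Pair D_add D_scale B_add B_scale
        mul_add_left mul_scale_left parity_inv_add parity_inv_scale algebra_simps)
    show "u \<odot> v \<in> kG (x + y)" if "u \<in> kG x" "v \<in> kG y" for u v x y
    proof -
      obtain a X \<alpha> b Y \<beta> where uv: "u = (a, X, \<alpha>)" "v = (b, Y, \<beta>)" by (metis prod_cases3)
      show ?thesis
        using that unfolding uv
        by (cases x; cases y) (auto simp: kmul_Pair kG_iff grade_simps B_even)
    qed
    show "u \<odot> v = - kscale (psign (x * y)) (v \<odot> u)" if "u \<in> kG x" "v \<in> kG y" for u v x y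
    proof -
      obtain a X \<alpha> b Y \<beta> where uv: "u = (a, X, \<alpha>)" "v = (b, Y, \<beta>)" by (metis prod_cases3)
      then have X: "X \<in> G x" and Y: "Y \<in> G y" using that by (auto simp: kG_iff)
      \<comment> \<open>This is graded skew-symmetry of the coefficient of \<open>e\<^sup>*\<close>
        in \<open>XY\<close>: the shift of degree in the supersymmetry of \<open>B\<close> cancels
        the sign in the rule for \<open>D\<close>.\<close>
      have "B (D X) Y = - (psign (x * y) * B (D Y) X)"
        using D_skew[OF Y, of X] B_supersym[OF Y D_graded[OF X]]
        by (cases x; cases y) simp_all
      then show ?thesis
        using that mul_skew[OF X Y] unfolding uv
        by (cases x; cases y) (auto simp: kmul_Pair kscale_Pair kG_iff grade_simps D_minus B_minus
            B_even(2)[OF _ A0_even] algebra_simps)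
    qed
  qed
qed

sublocale k: skew_superalgebra kscale kG kmul
  by (rule skew_superalgebra_dext)

section \<open>The Malcev identity modulo the central line\<close>

lemma k_odd_decomp:
  assumes "u \<in> kG 1"
  shows "\<exists>a. \<exists>w\<in>({0} \<times> UNIV) \<inter> kG 1. u = kscale a (1, 0, 0) + w"
  using assms by (intro exI[of _ "fst u"] bexI[of _ "(0, snd u)"]; cases u)
    (auto simp: kG_iff kscale_Pair)

text \<open>Products do not depend on the \<open>e\<^sup>*\<close>-coordinates of their factors and
  have no \<open>e\<close>-component. Testing on \<open>W\<close>, which is the sum of
  \<open>M\<close> and the central line, thus comes down to comparing \<open>M\<close>-coordinates
  for arguments from \<open>M\<close>.\<close>

lemma k_malcev_defect_mod_center:
  assumes "X \<in> kG x" "Y \<in> kG y" "Z \<in> kG z" "T \<in> kG t"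
  shows "k.malcev_defect x y z t X Y Z T \<in> {0} \<times> {0} \<times> UNIV"
proof (rule k.malcev_defect_mem[where e = "(1, 0, 0)" and W = "{0} \<times> UNIV"])
  show "k.subspace ({0} \<times> {0} \<times> UNIV)"
    by (auto simp: k.subspace_def kscale_Pair zero_prod_def)
  show "(1, 0, 0) \<in> kG 1"
    by (simp add: kG_iff)
  show "u \<in> {0} \<times> UNIV" if "u \<in> kG 0" for u
    using that by (cases u) (simp add: kG_iff)
  show "\<exists>a. \<exists>w\<in>({0} \<times> UNIV) \<inter> kG 1. u = kscale a (1, 0, 0) + w" if "u \<in> kG 1" for u
    using that by (rule k_odd_decomp)
next
  fix x y z t X Y Z T
  assume X: "X \<in> ({0} \<times> UNIV) \<inter> kG x" and Y: "Y \<in> ({0} \<times> UNIV) \<inter> kG y"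
    and Z: "Z \<in> ({0} \<times> UNIV) \<inter> kG z" and T: "T \<in> ({0} \<times> UNIV) \<inter> kG t"
  obtain X' \<alpha> Y' \<beta> Z' \<gamma> T' \<delta> where eq: "X = (0, X', \<alpha>)" "Y = (0, Y', \<beta>)"
      "Z = (0, Z', \<gamma>)" "T = (0, T', \<delta>)"
    using X Y Z T by (metis IntD1 SigmaE singletonD surj_pair)
  have G: "X' \<in> G x" "Y' \<in> G y" "Z' \<in> G z" "T' \<in> G t"
    using X Y Z T by (auto simp: eq kG_iff)
  show "k.malcev_defect x y z t X Y Z T \<in> {0} \<times> {0} \<times> UNIV"
    using malcev_identity[OF G]
    unfolding k.malcev_defect_def eq by (simp add: kmul_Pair kscale_Pair)
next
  fix y z t Y Z T
  assume Y: "Y \<in> ({0} \<times> UNIV) \<inter> kG y"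
    and Z: "Z \<in> ({0} \<times> UNIV) \<inter> kG z" and T: "T \<in> ({0} \<times> UNIV) \<inter> kG t"
  obtain Y' \<beta> Z' \<gamma> T' \<delta> where eq: "Y = (0, Y', \<beta>)" "Z = (0, Z', \<gamma>)" "T = (0, T', \<delta>)"
    using Y Z T by (metis IntD1 SigmaE singletonD surj_pair)
  have G: "Y' \<in> G y" "Z' \<in> G z" "T' \<in> G t"
    using Y Z T by (auto simp: eq kG_iff)
  show "k.malcev_defect 1 y z t (1, 0, 0) Y Z T \<in> {0} \<times> {0} \<times> UNIV"
    using D_malcev[OF G] G unfolding k.malcev_defect_def eq
    by (cases y; cases z; cases t)
      (simp_all add: kmul_Pair kscale_Pair grade_simps D_minus mul_minus_left mul_minus_right algebra_simps)
next
  fix z t Z T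
  assume Z: "Z \<in> ({0} \<times> UNIV) \<inter> kG z" and T: "T \<in> ({0} \<times> UNIV) \<inter> kG t"
  obtain Z' \<gamma> T' \<delta> where eq: "Z = (0, Z', \<gamma>)" "T = (0, T', \<delta>)"
    using Z T by (metis IntD1 SigmaE singletonD surj_pair)
  have G: "Z' \<in> G z" "T' \<in> G t"
    using Z T by (auto simp: eq kG_iff)
  show "k.malcev_defect 1 1 z t (1, 0, 0) (1, 0, 0) Z T \<in> {0} \<times> {0} \<times> UNIV"
    using A0_mul_mul[OF G] G unfolding k.malcev_defect_def eq
    by (cases z; cases t)
      (simp_all add: kmul_Pair kscale_Pair grade_simps D_minus mul_minus_left mul_minus_right algebra_simps)
  show "k.malcev_defect 1 z 1 t (1, 0, 0) Z (1, 0, 0) T \<in> {0} \<times> {0} \<times> UNIV"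
    using mul_A0_mul[OF G] G unfolding k.malcev_defect_def eq
    by (cases z; cases t)
      (simp_all add: kmul_Pair kscale_Pair grade_simps D_minus mul_minus_left mul_minus_right algebra_simps)
next
  fix t T
  assume T: "T \<in> ({0} \<times> UNIV) \<inter> kG t"
  obtain T' \<delta> where eq: "T = (0, T', \<delta>)"
    using T by (metis IntD1 SigmaE singletonD surj_pair)
  have G: "T' \<in> G t"
    using T by (auto simp: eq kG_iff)
  show "k.malcev_defect 1 1 1 t (1, 0, 0) (1, 0, 0) (1, 0, 0) T \<in> {0} \<times> {0} \<times> UNIV"
    using D_A0_mul[OF G] G unfolding k.malcev_defect_def eq
    by (cases t)
      (simp_all add: kmul_Pair kscale_Pair grade_simps D_minus mul_minus_left mul_minus_right algebra_simps)
next
  show "k.malcev_defect 1 1 1 1 (1, 0, 0) (1, 0, 0) (1, 0, 0) (1, 0, 0) \<in> {0} \<times> {0} \<times> UNIV"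
    unfolding k.malcev_defect_def by (simp add: kmul_Pair kscale_Pair A0_square)
qed (use assms in auto)

section \<open>The invariant form and the full Malcev identity\<close>

lemma dext_form_Pair: "dext_form B (a, X, \<alpha>) (b, Y, \<beta>) = B X Y + \<alpha> * b - a * \<beta>"
  by (simp add: dext_form_def)

lemma dext_form_linear:
  "Vector_Spaces.linear kscale (*) (\<lambda>v. dext_form B u v)"
  "Vector_Spaces.linear kscale (*) (\<lambda>u. dext_form B u v)"
proof -
  have vs: "vector_space ((*) :: 'k \<Rightarrow> 'k \<Rightarrow> 'k)"
    using superspace_odd_line by (rule superspace.axioms)
  show "Vector_Spaces.linear kscale (*) (\<lambda>v. dext_form B u v)"
    unfolding Vector_Spaces.linear_iff by (cases u) (auto simp: k.vector_space_axioms vs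
        dext_form_Pair kscale_Pair B_add B_scale algebra_simps)
  show "Vector_Spaces.linear kscale (*) (\<lambda>u. dext_form B u v)"
    unfolding Vector_Spaces.linear_iff by (cases v) (auto simp: k.vector_space_axioms vs
        dext_form_Pair kscale_Pair B_add B_scale algebra_simps)
qed

text \<open>Sort by the \<open>e\<close>-coordinates \<open>a\<close>, \<open>b\<close>,
  \<open>c\<close>. The terms in \<open>b\<close> alone agree by \<open>B_D_P_left\<close>, those in
  \<open>c\<close> alone by \<open>B_D_P_right\<close>, those in \<open>ab\<close> by
  \<open>B_A0_commute\<close>, and those free of all three by invariance of \<open>B\<close>; the
  others agree literally.\<close>

lemma dext_form_invariant: "dext_form B (u \<odot> v) w = dext_form B u (v \<odot> w)"
proof -
  obtain a X \<alpha> b Y \<beta> c Z \<gamma> where "u = (a, X, \<alpha>)" "v = (b, Y, \<beta>)" "w = (c, Z, \<gamma>)"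
    by (metis prod_cases3)
  then show ?thesis
    by (simp add: kmul_Pair dext_form_Pair B_add B_diff B_scale B_invariant B_D_P_left B_D_P_right
        B_A0_commute algebra_simps)
qed

text \<open>Every pattern except four times \<open>e\<close> contains an argument without
  \<open>e\<close>-component. Rotation brings it to the front, where invariance can move it out of
  the defect.\<close>

lemma k_malcev_defect_eq_0:
  assumes "X \<in> kG x" "Y \<in> kG y" "Z \<in> kG z" "T \<in> kG t"
  shows "k.malcev_defect x y z t X Y Z T = 0"
proof -
  have e: "(1, 0, 0) \<in> kG 1" by (simp add: kG_iff)
  have W: "k.malcev_defect x y z t X Y Z T = 0"
    if X: "X \<in> ({0} \<times> UNIV) \<inter> kG x" and mem: "Y \<in> kG y" "Z \<in> kG z" "T \<in> kG t" for x y z t X Y Z T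
  proof -
    \<comment> \<open>The \<open>e\<^sup>*\<close>-coordinate is the value of the form at \<open>e\<close>; move \<open>X\<close> out of the defect.\<close>
    obtain X' \<alpha> where X': "X = (0, X', \<alpha>)"
      using X by (cases X) auto
    obtain \<beta> where \<beta>: "k.malcev_defect x y z t X Y Z T = (0, 0, \<beta>)"
      using k_malcev_defect_mod_center[of X x Y y Z z T t] X mem by auto
    obtain \<gamma> where \<gamma>: "k.malcev_defect z y t 1 Z Y T (1, 0, 0) = (0, 0, \<gamma>)"
      using k_malcev_defect_mod_center[OF mem(2,1,3) e] by auto
    have "dext_form B (k.malcev_defect x y z t X Y Z T) (1, 0, 0) =
        psign (y * z) * dext_form B X (k.malcev_defect z y t 1 Z Y T (1, 0, 0))"
      using X mem e
      by (intro k.malcev_defect_invariant dext_form_linear dext_form_invariant) auto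
    \<comment> \<open>Pairing with \<open>e\<close> reads off \<beta> on the left. On the right
      \<open>X\<close> has no \<open>e\<close>-component, so it is orthogonal to the central vector
      \<open>(0, 0, \<gamma>)\<close>.\<close>
    then have "\<beta> = 0"
      unfolding \<beta> \<gamma> by (simp add: dext_form_Pair X')
    with \<beta> show ?thesis by (simp add: zero_prod_def)
  qed
  have rot: "k.malcev_defect x y z t X Y Z T = 0"
    if "X \<in> kG x" "Y \<in> kG y" "Z \<in> kG z" "T \<in> kG t" "k.malcev_defect y z t x Y Z T X = 0"
    for x y z t X Y Z T
    using k.malcev_defect_cycle[OF that(1-4)] that(5) by (simp add: psign_def split: if_splits)
  have "k.malcev_defect x y z t X Y Z T \<in> {0}"
  proof (rule k.malcev_defect_mem[where e = "(1, 0, 0)" and W = "{0} \<times> UNIV"])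
    \<comment> \<open>The triple products cancel by their alternating signs. What remains is
      \<open>(ee)(ee)\<close>, whose \<open>e\<^sup>*\<close>-coordinate
      \<open>- B (D A0) A0\<close> vanishes because \<open>D A0\<close> is odd and \<open>A0\<close>
      even.\<close>
    show "k.malcev_defect 1 1 1 1 (1, 0, 0) (1, 0, 0) (1, 0, 0) (1, 0, 0) \<in> {0}"
      unfolding k.malcev_defect_def
      using B_even(2)[OF D_graded[OF A0_even, simplified] A0_even]
      by (simp add: kmul_Pair kscale_Pair A0_square zero_prod_def)
  next
    fix x y z t X Y Z T
    assume "X \<in> ({0} \<times> UNIV) \<inter> kG x" "Y \<in> ({0} \<times> UNIV) \<inter> kG y"
      "Z \<in> ({0} \<times> UNIV) \<inter> kG z" "T \<in> ({0} \<times> UNIV) \<inter> kG t"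
    then show "k.malcev_defect x y z t X Y Z T \<in> {0}"
      by (simp add: W)
  next
    fix y z t Y Z T
    assume "Y \<in> ({0} \<times> UNIV) \<inter> kG y" "Z \<in> ({0} \<times> UNIV) \<inter> kG z" "T \<in> ({0} \<times> UNIV) \<inter> kG t"
    then have "k.malcev_defect 1 y z t (1, 0, 0) Y Z T = 0"
      using e by (intro rot[OF _ _ _ _ W]) blast+
    then show "k.malcev_defect 1 y z t (1, 0, 0) Y Z T \<in> {0}" by simp
  next
    fix z t Z T
    assume ZT: "Z \<in> ({0} \<times> UNIV) \<inter> kG z" "T \<in> ({0} \<times> UNIV) \<inter> kG t"
    then have "k.malcev_defect 1 1 z t (1, 0, 0) (1, 0, 0) Z T = 0"
      using e by (intro rot[OF _ _ _ _ rot[OF _ _ _ _ W]]) blast+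
    then show "k.malcev_defect 1 1 z t (1, 0, 0) (1, 0, 0) Z T \<in> {0}" by simp
    have "k.malcev_defect 1 z 1 t (1, 0, 0) Z (1, 0, 0) T = 0"
      using e ZT by (intro rot[OF _ _ _ _ W]) blast+
    then show "k.malcev_defect 1 z 1 t (1, 0, 0) Z (1, 0, 0) T \<in> {0}" by simp
  next
    fix t T
    assume "T \<in> ({0} \<times> UNIV) \<inter> kG t"
    then have "k.malcev_defect 1 1 1 t (1, 0, 0) (1, 0, 0) (1, 0, 0) T = 0"
      using e by (intro rot[OF _ _ _ _ rot[OF _ _ _ _ rot[OF _ _ _ _ W]]]) blast+
    then show "k.malcev_defect 1 1 1 t (1, 0, 0) (1, 0, 0) (1, 0, 0) T \<in> {0}" by simp
  next
    show "u \<in> {0} \<times> UNIV" if "u \<in> kG 0" for u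
      using that by (cases u) (simp add: kG_iff)
  qed (use assms e k_odd_decomp in auto)
  then show ?thesis by simp
qed

lemma malcev_superalgebra_dext: "malcev_superalgebra kscale kG kmul"
  using k_malcev_defect_eq_0 by (simp add: k.malcev_superalgebra_iff)

lemma quadratic_malcev_superalgebra_dext:
  "quadratic_malcev_superalgebra kscale kG kmul (dext_form B)"
proof (intro quadratic_malcev_superalgebra.intro quadratic_malcev_superalgebra_axioms.intro
    malcev_superalgebra_dext dext_form_linear dext_form_invariant)
  show "dext_form B X Y = 0" if "X \<in> kG 0" "Y \<in> kG 1" for X Y
    using that by (cases X; cases Y) (auto simp: kG_iff dext_form_Pair B_even)
  show "dext_form B X Y = 0" if "X \<in> kG 1" "Y \<in> kG 0" for X Y
    using that by (cases X; cases Y) (auto simp: kG_iff dext_form_Pair B_even)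
  show "dext_form B X Y = psign (x * y) * dext_form B Y X" if "X \<in> kG x" "Y \<in> kG y" for X Y x y
  proof -
    obtain a X' \<alpha> b Y' \<beta> where eq: "X = (a, X', \<alpha>)" "Y = (b, Y', \<beta>)" by (metis prod_cases3)
    then have "B X' Y' = psign (x * y) * B Y' X'"
      using that by (intro B_supersym) (auto simp: kG_iff)
    then show ?thesis
      using that unfolding eq by (cases x; cases y) (auto simp: kG_iff dext_form_Pair)
  qed
  show "X = 0" if *: "\<And>Y. dext_form B X Y = 0" for X
  proof -
    obtain a X' \<alpha> where eq: "X = (a, X', \<alpha>)" by (metis prod_cases3)
    have "X' = 0"
    proof (rule B_nondegenerate)
      show "B X' Y = 0" for Y using *[of "(0, Y, 0)"] by (simp add: eq dext_form_Pair)
    qed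
    then show ?thesis
      using *[of "(1, 0, 0)"] *[of "(0, 0, 1)"] by (simp add: eq dext_form_Pair zero_prod_def)
  qed
qed

section \<open>The central extension and the generalized semi-direct product\<close>

sublocale ke: malcev_superalgebra kscale kG kmul
  by (rule malcev_superalgebra_dext)

text \<open>The central extension is the subalgebra of vectors without \<open>e\<close>-component,
  so it inherits skew-symmetry and the Malcev identity.\<close>

lemma kmul_0_Pair: "(0, f) \<odot> (0, h) = (0, vmul f h)"
  by (cases f; cases h) (simp add: kmul_Pair vmul_Pair)

lemma kscale_0_Pair: "kscale c (0, f) = (0, vscale c f)"
  by (cases f) (simp add: kscale_Pair vscale_Pair)

lemma kG_0_Pair: "(0, f) \<in> kG x \<longleftrightarrow> f \<in> vG x"
  by (simp add: sum_grading_def odd_line_def)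

lemmas ext_simps = kmul_0_Pair kscale_0_Pair add_Pair diff_Pair uminus_Pair

lemma malcev_superalgebra_cext: "malcev_superalgebra vscale vG vmul"
proof -
  interpret v: superspace vscale vG by (rule superspace_cext)
  show ?thesis
  proof (intro malcev_superalgebra.intro superalgebra.intro superalgebra_axioms.intro
      malcev_superalgebra_axioms.intro superspace_cext)
    show "Vector_Spaces.linear vscale vscale (\<lambda>v. vmul u v)" for u
      unfolding Vector_Spaces.linear_iff
      by (cases u) (auto simp: v.vector_space_axioms vmul_Pair vscale_Pair B_add B_scale
        mul_add_right mul_scale_right)
    show "Vector_Spaces.linear vscale vscale (\<lambda>u. vmul u v)" for v
      unfolding Vector_Spaces.linear_iff
      by (cases v) (auto simp: v.vector_space_axioms vmul_Pair vscale_Pair D_add D_scale B_add B_scale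
        mul_add_left mul_scale_left)
    show "vmul u v \<in> vG (x + y)" if "u \<in> vG x" "v \<in> vG y" for u v x y
      using k.mul_graded[of "(0, u)" x "(0, v)" y] that by (simp only: kG_0_Pair ext_simps)
    show "vmul u v = - vscale (psign (x * y)) (vmul v u)" if "u \<in> vG x" "v \<in> vG y" for u v x y
      using k.mul_skew[of "(0, u)" x "(0, v)" y] that by (simp add: kG_0_Pair ext_simps)
    fix X Y Z T x y z t
    assume "X \<in> vG x" "Y \<in> vG y" "Z \<in> vG z" "T \<in> vG t"
    then show "vscale (psign (y * z)) (vmul (vmul X Z) (vmul Y T)) =
        vmul (vmul (vmul X Y) Z) T
        + vscale (psign (x * (y + z + t))) (vmul (vmul (vmul Y Z) T) X)
        + vscale (psign ((x + y) * (z + t))) (vmul (vmul (vmul Z T) X) Y)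
        + vscale (psign (t * (x + y + z))) (vmul (vmul (vmul T X) Y) Z)"
      using ke.malcev_identity[of "(0, X)" x "(0, Y)" y "(0, Z)" z "(0, T)" t]
      by (simp add: kG_0_Pair ext_simps del: add_bit_eq_xor mult_bit_eq_and)
  qed
qed

lemma vscale_cext_op: "(a, 0) \<odot> (0, f) = (0, vscale a (cext_op G B D A0 f))"
  by (cases f) (simp add: kmul_Pair vscale_Pair cext_op_def B_A0_P zero_prod_def)

text \<open>The operator is the restriction of left multiplication by the odd element
  \<open>(a, 0)\<close>, that is, by \<open>a\<close> times \<open>e\<close>. Its values have no
  \<open>e\<close>-component, so the operator condition restricts as well.\<close>

lemma cext_op_mem: "(\<lambda>f. vscale a (cext_op G B D A0 f)) \<in> malcev_ops vscale vG vmul"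
proof -
  interpret v: malcev_superalgebra vscale vG vmul by (rule malcev_superalgebra_cext)
  let ?\<Omega> = "\<lambda>f. vscale a (cext_op G B D A0 f)"
  have lin: "Vector_Spaces.linear vscale vscale ?\<Omega>"
    unfolding Vector_Spaces.linear_iff
    by (auto simp: v.vector_space_axioms vscale_Pair cext_op_def B_A0_P B_add B_scale D_add D_scale
        algebra_simps)
  have "(a, 0) \<in> kG 1"
    by (simp add: kG_iff zero_prod_def)
  then have op: "(\<lambda>u. (a, 0) \<odot> u) \<in> malcev_ops kscale kG kmul"
    by (rule ke.odd_left_mult_malcev_op)
  have "?\<Omega> (vmul (vmul X Y) Z) =
      vmul (vmul (?\<Omega> X) Y) Z
      - vscale (psign (x * y)) (vmul (?\<Omega> Y) (vmul X Z))
      - vscale (psign (z * (x + y))) (vmul (vmul (?\<Omega> Z) X) Y)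
      - vscale (psign (x * (y + z))) (vmul (?\<Omega> (vmul Y Z)) X)"
    if "X \<in> vG x" "Y \<in> vG y" "Z \<in> vG z" for x y z X Y Z
  proof -
    have "(a, 0) \<odot> (((0, X) \<odot> (0, Y)) \<odot> (0, Z)) =
      (((a, 0) \<odot> (0, X)) \<odot> (0, Y)) \<odot> (0, Z)
      - kscale (psign (x * y)) (((a, 0) \<odot> (0, Y)) \<odot> ((0, X) \<odot> (0, Z)))
      - kscale (psign (z * (x + y))) ((((a, 0) \<odot> (0, Z)) \<odot> (0, X)) \<odot> (0, Y))
      - kscale (psign (x * (y + z))) (((a, 0) \<odot> ((0, Y) \<odot> (0, Z))) \<odot> (0, X))"
      using op that unfolding malcev_ops_def mem_Collect_eq kG_0_Pair[symmetric] by blast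
    then show ?thesis
      by (simp add: ext_simps vscale_cext_op del: add_bit_eq_xor mult_bit_eq_and)
  qed
  with lin show ?thesis
    unfolding malcev_ops_def by blast
qed

lemma malcev_superalgebra_odd_line:
  "malcev_superalgebra (*) (odd_line :: bit \<Rightarrow> 'k set) (\<lambda>_ _. 0)"
proof -
  interpret line: superspace "(*)" "odd_line :: bit \<Rightarrow> 'k set" by (rule superspace_odd_line)
  show ?thesis
    by unfold_locales (auto simp: line.subspace_0[OF line.subspace_G])
qed

lemma generalized_semidirect_product_dext:
  "generalized_semidirect_product (*) odd_line (\<lambda>_ _. 0) vscale vG vmul
     (\<lambda>a f. vscale a (cext_op G B D A0 f)) (\<lambda>a b. vscale (a * b) (A0, 0)) kmul"
proof -
  interpret v: malcev_superalgebra vscale vG vmul by (rule malcev_superalgebra_cext)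
  have vs: "vector_space ((*) :: 'k \<Rightarrow> 'k \<Rightarrow> 'k)"
    using superspace_odd_line by (rule superspace.axioms)
  have lin: "Vector_Spaces.linear (*) vscale (\<lambda>a. vscale a f)" for f
    unfolding Vector_Spaces.linear_iff
    by (auto simp: vs v.vector_space_axioms v.scale_left_distrib)
  show ?thesis
    unfolding generalized_semidirect_product_def
  proof (intro conjI allI ballI malcev_superalgebra_odd_line malcev_superalgebra_cext cext_op_mem lin
      malcev_superalgebra_dext)
    show "Vector_Spaces.linear (*) vscale (\<lambda>b. vscale (a * b) (A0, 0))" for a
      unfolding Vector_Spaces.linear_iff
      by (auto simp: vs v.vector_space_axioms v.scale_left_distrib algebra_simps)
    show "Vector_Spaces.linear (*) vscale (\<lambda>a. vscale (a * b) (A0, 0))" for b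
      unfolding Vector_Spaces.linear_iff
      by (auto simp: vs v.vector_space_axioms v.scale_left_distrib algebra_simps)
    fix x y :: bit and a b :: 'k
    assume ab: "a \<in> odd_line x" "b \<in> odd_line y"
    show "vscale (a * b) (A0, 0) \<in> vG (x + y)"
      using ab by (cases x; cases y) (simp_all add: odd_line_def vscale_Pair vG_iff grade_simps)
    show "vscale (a * b) (A0, 0) = - vscale (psign (x * y)) (vscale (b * a) (A0, 0))"
      using ab by (cases x; cases y) (simp_all add: odd_line_def vscale_Pair mult.commute)
    fix f h
    assume "f \<in> vG x" "h \<in> vG y"
    \<comment> \<open>A nonzero \<open>b\<close> forces \<open>y = 1\<close>, so the sign
      \<open>psign (x * y)\<close> becomes that of the parity involution in \<open>kmul\<close>. In
      the \<open>e\<^sup>*\<close>-coordinate the sign is immaterial, as \<open>A0\<close> is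
      orthogonal to odd vectors.\<close>
    then show "(a, f) \<odot> (b, h) =
       (0, vmul f h + vscale a (cext_op G B D A0 h)
           - vscale (psign (x * y)) (vscale b (cext_op G B D A0 f)) + vscale (a * b) (A0, 0))"
      using ab by (cases f; cases h; cases x; cases y)
        (auto simp: odd_line_def vG_iff kmul_Pair vmul_Pair vscale_Pair cext_op_def B_A0_P
          grade_simps D_minus B_even(2)[OF _ A0_even] algebra_simps)
  qed
qed

end

theorem theorem2p3:
  fixes scale :: "'k::{alg_closed_field, field_char_0} \<Rightarrow> 'a::ab_group_add \<Rightarrow> 'a" (infixr \<open>*s\<close> 75)
    and Basis :: "'a set"
    and G :: "bit \<Rightarrow> 'a set"
    and mul :: "'a \<Rightarrow> 'a \<Rightarrow> 'a" (infixl \<open>\<cdot>\<close> 78)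
    and B :: "'a \<Rightarrow> 'a \<Rightarrow> 'k"
    and D :: "'a \<Rightarrow> 'a"
    and A0 :: 'a
  assumes "quadratic_malcev_superalgebra scale G mul B"
    and "finite_dimensional_vector_space scale Basis"
    and "D \<in> skew_malcev_ops scale G mul B 1"
    and "A0 \<in> G 0"
    and "D (D A0) = (1 / 2) *s (A0 \<cdot> A0)"
    and "\<And>X x. X \<in> G x \<Longrightarrow> D (A0 \<cdot> X) = A0 \<cdot> D X - D A0 \<cdot> X"
    and "\<And>X Y x y. X \<in> G x \<Longrightarrow> Y \<in> G y \<Longrightarrow>
      (A0 \<cdot> X) \<cdot> Y =
        D (D X \<cdot> Y) + D (D (X \<cdot> Y)) + psign x *s (D X \<cdot> D Y) + psign (x * y) *s (D (D Y) \<cdot> X)"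
    and "\<And>X Y x y. X \<in> G x \<Longrightarrow> Y \<in> G y \<Longrightarrow>
      A0 \<cdot> (X \<cdot> Y) =
        D (D X \<cdot> Y) + D (D X) \<cdot> Y - psign (x * y) *s (D (D Y) \<cdot> X + D (D Y \<cdot> X))"
  shows
    \<comment> \<open>the multiplication table, with \<open>e = (1, 0, 0)\<close> and \<open>e\<^sup>* = (0, 0, 1)\<close>\<close>
    "(dext_mul scale G mul B D A0 (1, 0, 0) (1, 0, 0) = (0, A0, 0) \<and>
      (\<forall>x. \<forall>X\<in>G x.
        dext_mul scale G mul B D A0 (1, 0, 0) (0, X, 0) = (0, D X, - (psign x * B X A0))) \<and>
      (\<forall>X Y. dext_mul scale G mul B D A0 (0, X, 0) (0, Y, 0) = (0, X \<cdot> Y, - B (D X) Y)) \<and>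
      (\<forall>v. dext_mul scale G mul B D A0 (0, 0, 1) v = 0)) \<and>
     generalized_semidirect_product
      (*) odd_line (\<lambda>_ _. 0)
      (cext_scale scale) (cext_grading G) (cext_mul mul B D)
      (\<lambda>a f. cext_scale scale a (cext_op G B D A0 f))
      (\<lambda>a b. cext_scale scale (a * b) (A0, 0))
      (dext_mul scale G mul B D A0) \<and>
     malcev_superalgebra (dext_scale scale) (dext_grading G) (dext_mul scale G mul B D A0) \<and>
     quadratic_malcev_superalgebra (dext_scale scale) (dext_grading G)
      (dext_mul scale G mul B D A0) (dext_form B)"
proof -
  interpret double_extension_datum scale G mul B D A0
    using assms(1,3,4,6-8)
    by (intro double_extension_datum.intro double_extension_datum_axioms.intro)
  \<comment> \<open>\<open>kmul_Pair\<close> shows no sign here; for odd \<open>X\<close> both forms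
    of the last coordinate are 0.\<close>
  have eX: "(1, 0, 0) \<odot> (0, X, 0) = (0, D X, - (psign x * B X A0))" if "X \<in> G x" for x X
    using that B_even(2)[OF _ A0_even] by (cases x) (simp_all add: kmul_Pair)
  have e_star: "(0, 0, 1) \<odot> v = 0" for v
    by (cases v) (simp add: kmul_Pair zero_prod_def)
  show ?thesis
    using eX e_star generalized_semidirect_product_dext malcev_superalgebra_dext
      quadratic_malcev_superalgebra_dext
    by (intro conjI allI ballI) (simp_all add: kmul_Pair)
qed

end
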